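(* Consider an instance $(X,U)$ of dimension $n$ of a problem class with cardinality bounds $\underline p,\bar p$ (with $\underline p(n)>0$) and cost bounds $0<m_\infty\le M_\infty$, and let $\tilde M(n):=\frac{M_\infty}{m_\infty}\frac{\bar p(n)}{\underline p(n)}$. For every $k\in[n]$, the solution returned by the selection algorithm (Algorithm 1, described in the context) satisfies $$\mathrm{approx}(k)\le\left(1+\tilde M(n)\,\frac{n-k}{k+1}\right)\mathrm{opt}(k')\qquad\text{for all }k'\ge k.$$
   Context: Notation: $\mathbb N=\{1,2,\dots\}$, $[k]=\{1,\dots,k\}$, $\mathbb R_+^n=\{x\in\mathbb R^n: x\ge 0\}$, and $\|x\|_0$ is the number of non-zero entries of $x$. An instance of dimension $n$ consists of a nonempty set $X\subseteq\{0,1\}^n$ and a nonempty convex set $U\subseteq\mathbb R_+^n$; all minima and maxima written are understood to be attained (e.g. $U$ compact). For $k\in\mathbb N$ the min-max-min robust problem $(\mathrm M^3(k))$ is $$\min_{x^{(1)},\dots,x^{(k)}\in X}\ \max_{c\in U}\ \min_{i=1,\dots,k} c^\top x^{(i)},$$ and $\mathrm{opt}(k)$ denotes its optimal value. A problem class has cardinality bounds $\underline p,\bar p:\mathbb N\to\mathbb R_+$ if for every instance of dimension $n$ in the class $\underline p(n)\le\|x\|_0\le\bar p(n)$ for all $x\in X$. Cost bounds $0<m_\infty\le M_\infty$ means that $m_\infty\le c_j\le M_\infty$ for all $c\in U$ and all $j\in[n]$. Algorithm 1 (input $n$, $k\in[n]$, $U$, $X$): (1) compute an optimal solution $x^1,\dots,x^n$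 of $(\mathrm M^3(n))$; (2) compute an optimal solution $\lambda^*$ of $\min\{\max_{c\in U}c^\top x:\ x=\sum_{i=1}^n\lambda_i x^i,\ \sum_{i=1}^n\lambda_i=1,\ \lambda\ge 0\}$; (3) sort $\lambda^*_{i_1}\ge\lambda^*_{i_2}\ge\dots\ge\lambda^*_{i_n}$; (4) return $x^{i_1},\dots,x^{i_k}$. The objective value of the returned solution is $\mathrm{approx}(k):=\max_{c\in U}\min_{j=1,\dots,k}c^\top x^{i_j}$. *)

theory Defs
  imports "HOL-Analysis.Analysis"
begin

text \<open>
  The dimension of an instance is \<open>n = CARD('n)\<close>. A \<open>k\<close>-tuple \<open>x\<close> of vectors is a
  function on \<open>nat\<close> of which only the values at \<open>1, \<dots>, k\<close> matter.
\<close>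

definition zero_norm :: "real ^ 'n \<Rightarrow> nat" where
  "zero_norm x = card {j. x $ j \<noteq> 0}"

text \<open>
  The maximum over \<open>U\<close> is written as a supremum and the minimum over tuples as an infimum;
  they are genuine maxima and minima under the attainment conditions imposed below.
\<close>

definition worst_cost :: "(real ^ 'n) set \<Rightarrow> nat \<Rightarrow> (nat \<Rightarrow> real ^ 'n) \<Rightarrow> real" where
  "worst_cost U k x = (SUP c\<in>U. MIN i\<in>{1..k}. c \<bullet> x i)"

definition opt :: "(real ^ 'n) set \<Rightarrow> (real ^ 'n) set \<Rightarrow> nat \<Rightarrow> real" where
  "opt X U k = (INF x\<in>{1..k} \<rightarrow> X. worst_cost U k x)"

definition optimal_tuple ::
    "(real ^ 'n) set \<Rightarrow> (real ^ 'n) set \<Rightarrow> nat \<Rightarrow> (nat \<Rightarrow> real ^ 'n) \<Rightarrow> bool" where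
  "optimal_tuple X U k x \<longleftrightarrow> is_arg_min (worst_cost U k) (\<lambda>x. x \<in> {1..k} \<rightarrow> X) x"

definition weights :: "nat \<Rightarrow> (nat \<Rightarrow> real) set" where
  "weights k = {l. (\<forall>i\<in>{1..k}. 0 \<le> l i) \<and> (\<Sum>i=1..k. l i) = 1}"

definition combination :: "nat \<Rightarrow> (nat \<Rightarrow> real ^ 'n) \<Rightarrow> (nat \<Rightarrow> real) \<Rightarrow> real ^ 'n" where
  "combination k x l = (\<Sum>i=1..k. l i *\<^sub>R x i)"

definition optimal_weights ::
    "(real ^ 'n) set \<Rightarrow> nat \<Rightarrow> (nat \<Rightarrow> real ^ 'n) \<Rightarrow> (nat \<Rightarrow> real) \<Rightarrow> bool" where
  "optimal_weights U k x l \<longleftrightarrow>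
     is_arg_min (\<lambda>l. SUP c\<in>U. c \<bullet> combination k x l) (\<lambda>l. l \<in> weights k) l"

text \<open>
  Attainment of the maxima over \<open>U\<close> occurring in the robust problems and in the second step
  of the selection algorithm. No condition on the minima is needed: the tuples over the finite
  set \<open>X\<close> take finitely many values, and the selection algorithm starts from a given minimizer
  over the weights.
\<close>

definition maxima_attained :: "(real ^ 'n) set \<Rightarrow> (real ^ 'n) set \<Rightarrow> bool" where
  "maxima_attained X U \<longleftrightarrow>
     (\<forall>k\<ge>1::nat. \<forall>x\<in>{1..k} \<rightarrow> X. \<exists>c. is_arg_max (\<lambda>c. MIN i\<in>{1..k}. c \<bullet> x i) (\<lambda>c. c \<in> U) c) \<and>
     (\<forall>x. optimal_tuple X U CARD('n) x \<longrightarrow>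
       (\<forall>l\<in>weights CARD('n). \<exists>c. is_arg_max (\<lambda>c. c \<bullet> combination CARD('n) x l) (\<lambda>c. c \<in> U) c))"

definition is_instance :: "(real ^ 'n) set \<Rightarrow> (real ^ 'n) set \<Rightarrow> bool" where
  "is_instance X U \<longleftrightarrow>
     X \<noteq> {} \<and> (\<forall>x\<in>X. \<forall>j. x $ j \<in> {0, 1}) \<and>
     U \<noteq> {} \<and> convex U \<and> (\<forall>c\<in>U. \<forall>j. 0 \<le> c $ j) \<and>
     maxima_attained X U"

text \<open>
  A problem class is represented by the set \<open>C\<close> of its instances of dimension \<open>CARD('n)\<close>,
  so the bounds \<open>p_lo\<close> and \<open>p_hi\<close> constrain \<open>C\<close> only through their values at that dimension.
\<close>

definition cardinality_bounds ::
    "((real ^ 'n) set \<times> (real ^ 'n) set) set \<Rightarrow> (nat \<Rightarrow> real) \<Rightarrow> (nat \<Rightarrow> real) \<Rightarrow> bool" where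
  "cardinality_bounds C p_lo p_hi \<longleftrightarrow>
     (\<forall>n\<ge>1. 0 \<le> p_lo n \<and> 0 \<le> p_hi n) \<and>
     (\<forall>(X, U)\<in>C. \<forall>x\<in>X.
        p_lo CARD('n) \<le> real (zero_norm x) \<and> real (zero_norm x) \<le> p_hi CARD('n))"

definition cost_bounds :: "(real ^ 'n) set \<Rightarrow> real \<Rightarrow> real \<Rightarrow> bool" where
  "cost_bounds U m M \<longleftrightarrow> 0 < m \<and> m \<le> M \<and> (\<forall>c\<in>U. \<forall>j. m \<le> c $ j \<and> c $ j \<le> M)"

definition M_tilde ::
    "real \<Rightarrow> real \<Rightarrow> (nat \<Rightarrow> real) \<Rightarrow> (nat \<Rightarrow> real) \<Rightarrow> nat \<Rightarrow> real" where
  "M_tilde m M p_lo p_hi n = (M / m) * (p_hi n / p_lo n)"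

text \<open>
  \<open>selection_output X U k y\<close> states that \<open>y 1, \<dots>, y k\<close> is a possible result of the selection
  algorithm; it is a relation because optimal solutions and the sorting order need not be unique.
  The map \<open>s\<close> sends \<open>j\<close> to the index \<open>i\<^sub>j\<close>.
\<close>

definition selection_output ::
    "(real ^ 'n) set \<Rightarrow> (real ^ 'n) set \<Rightarrow> nat \<Rightarrow> (nat \<Rightarrow> real ^ 'n) \<Rightarrow> bool" where
  "selection_output X U k y \<longleftrightarrow>
     (\<exists>x l s.
        optimal_tuple X U CARD('n) x \<and>
        optimal_weights U CARD('n) x l \<and>
        bij_betw s {1..CARD('n)} {1..CARD('n)} \<and>
        antimono_on {1..CARD('n)} (\<lambda>j. l (s j)) \<and>
        (\<forall>j\<in>{1..k}. y j = x (s j)))"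

end

theory Submission
  imports Defs
begin

text \<open>
  Linear programming duality (here: separation of the value set \<open>{(c \<bullet> x i)\<^sub>i | c \<in> U}\<close> from an
  open orthant) turns the value of a tuple into the worst-case cost of a single point of its convex
  hull. Hence \<open>opt X U k'\<close> is never smaller than the cost of some point of \<open>convex hull X\<close>. By
  Caratheodory, and because moving a point down to the frontier of a simplex does not increase its
  cost, that point may be taken in the convex hull of only \<open>n\<close> elements of \<open>X\<close>, so the point \<open>z\<close>
  computed by the algorithm costs at most \<open>opt X U k'\<close>. For every \<open>c\<close> the cheapest of the \<open>k\<close>
  selected vectors exceeds \<open>c \<bullet> z\<close> by at most its own cost times the weight of the discarded
  vectors; each discarded weight is at most \<open>1 / (k + 1)\<close>, being dominated by \<open>k\<close> others, and
  the costs of any two points of \<open>convex hull X\<close> differ at most by the factor \<open>M_tilde\<close>.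
\<close>

section \<open>Minimax by separating hyperplanes\<close>

text \<open>A negative entry of \<open>p\<close> would drive \<open>p \<bullet> v\<close> below any
  bound along that axis of the orthant; the second bound comes from approaching the corner where all
  coordinates equal \<open>t\<close>.\<close>

lemma inner_bounded_below_on_orthant:
  fixes p :: "real ^ 'i" and b t :: real
  assumes "\<And>v. (\<And>i. t < v $ i) \<Longrightarrow> b \<le> p \<bullet> v"
  shows "0 \<le> p $ i" and "b \<le> t * (\<Sum>i\<in>UNIV. p $ i)"
proof -
  define S where "S = (\<Sum>i\<in>UNIV. p $ i)"
  have shifted: "b \<le> (t + e) * S + r * p $ i" if "0 < e" "0 \<le> r" for e r i
  proof -
    have "b \<le> p \<bullet> (\<chi> j. t + e + (if j = i then r else 0))"
      using that by (intro assms) auto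
    also have "\<dots> = (\<Sum>j\<in>UNIV. p $ j * (t + e)) + (\<Sum>j\<in>UNIV. if j = i then p $ j * r else 0)"
      unfolding inner_vec_def sum.distrib[symmetric] by (intro sum.cong) (auto simp: algebra_simps)
    also have "\<dots> = (t + e) * S + r * p $ i"
      by (simp add: S_def sum_distrib_left mult.commute)
    finally show ?thesis .
  qed
  show "0 \<le> p $ i"
  proof (rule ccontr)
    assume "\<not> 0 \<le> p $ i"
    then have neg: "p $ i < 0" by simp
    \<comment> \<open>With \<open>e = 1\<close>, this \<open>r\<close> pushes the right-hand side of
      \<open>shifted\<close> below \<open>b\<close>; \<open>max 0\<close> meets the condition
      \<open>0 \<le> r\<close>, and \<open>+ 1\<close> makes the inequality strict.\<close>
    define r where "r = max 0 ((b - (t + 1) * S) / p $ i + 1)"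
    have "(b - (t + 1) * S) / p $ i < r" unfolding r_def by linarith
    then have "r * p $ i < b - (t + 1) * S"
      using neg by (simp add: neg_divide_less_eq)
    moreover have "b \<le> (t + 1) * S + r * p $ i"
      by (rule shifted) (auto simp: r_def)
    ultimately show False by linarith
  qed
  \<comment> \<open>The corner lies outside the open orthant, so it is reached only in the
    limit.\<close>
  have "((\<lambda>e. (t + e) * S) \<longlongrightarrow> (t + 0) * S) (at_right 0)"
    by (intro tendsto_intros)
  moreover have "\<forall>\<^sub>F e in at_right 0. b \<le> (t + e) * S"
    using shifted[of _ 0] by (simp add: eventually_at_filter)
  ultimately show "b \<le> t * (\<Sum>i\<in>UNIV. p $ i)"
    by (simp add: S_def tendsto_lowerbound)
qed

text \<open>The value vectors \<open>f c\<close> miss the open orthant \<open>B\<close>, because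
  each has an entry at most \<open>t\<close>. A separating normal is nonnegative and nonzero;
  normalised to sum 1, it supplies the convex weights of \<open>z\<close>.\<close>

lemma minimax_convex_hull_range:
  fixes w :: "'i::finite \<Rightarrow> 'a::real_inner" and t :: real
  assumes "convex U" "U \<noteq> {}" and le: "\<And>c. c \<in> U \<Longrightarrow> \<exists>i. c \<bullet> w i \<le> t"
  obtains z where "z \<in> convex hull range w" "\<And>c. c \<in> U \<Longrightarrow> c \<bullet> z \<le> t"
proof -
  define f :: "'a \<Rightarrow> real ^ 'i" where "f c = (\<chi> i. c \<bullet> w i)" for c
  define B :: "(real ^ 'i) set" where "B = {v. \<forall>i. t < v $ i}"
  have "linear f"
    by (rule linearI) (auto simp: f_def vec_eq_iff inner_add_left)
  then have "convex (f ` U)"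
    using \<open>convex U\<close> by (rule convex_linear_image)
  moreover have "convex B"
  proof -
    have "B = (\<Inter>i. {v. t < axis i 1 \<bullet> v})"
      by (auto simp: B_def inner_axis')
    then show ?thesis
      by (auto intro!: convex_INT convex_halfspace_gt)
  qed
  moreover have "(\<chi> i. t + 1) \<in> B" by (auto simp: B_def)
  then have "B \<noteq> {}" by blast
  moreover have "f ` U \<inter> B = {}"
    using le by (force simp: f_def B_def disjoint_iff not_less)
  ultimately obtain p b where "p \<noteq> 0"
    and sepU: "\<forall>v\<in>f ` U. p \<bullet> v \<le> b" and sepB: "\<forall>v\<in>B. b \<le> p \<bullet> v"
    using separating_hyperplane_sets[of "f ` U" B] \<open>U \<noteq> {}\<close> by auto
  have p_nonneg: "0 \<le> p $ i" and b_le: "b \<le> t * (\<Sum>i\<in>UNIV. p $ i)" for i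
    using inner_bounded_below_on_orthant[of t b p] sepB by (auto simp: B_def)
  define S where "S = (\<Sum>i\<in>UNIV. p $ i)"
  have "S \<noteq> 0"
    using p_nonneg \<open>p \<noteq> 0\<close> by (auto simp: S_def sum_nonneg_eq_0_iff vec_eq_iff)
  then have "0 < S"
    using p_nonneg by (metis S_def order_le_less sum_nonneg)
  define z where "z = (\<Sum>i\<in>UNIV. (p $ i / S) *\<^sub>R w i)"
  show thesis
  proof
    show "z \<in> convex hull range w"
      unfolding z_def using p_nonneg \<open>0 < S\<close>
      by (intro convex_sum)
        (auto simp: S_def hull_inc convex_convex_hull sum_divide_distrib[symmetric])
    show "c \<bullet> z \<le> t" if "c \<in> U" for c
    proof -
      have "c \<bullet> z = (\<Sum>i\<in>UNIV. p $ i * (c \<bullet> w i)) / S"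
        by (simp add: z_def inner_sum_right sum_divide_distrib)
      also have "\<dots> = (p \<bullet> f c) / S"
        by (simp add: f_def inner_vec_def)
      \<comment> \<open>Separation gives \<open>p \<bullet> f c \<le> b \<le> t * S\<close>.\<close>
      also have "\<dots> \<le> t"
        using sepU b_le that \<open>0 < S\<close> by (fastforce simp: divide_le_eq S_def)
      finally show ?thesis .
    qed
  qed
qed

text \<open>
  The subsets of the coordinates index the 0-1 vectors, which provides a finite type from which
  \<open>W\<close> is an image.
\<close>

lemma minimax_binary:
  fixes U W :: "(real ^ 'n) set" and t :: real
  assumes "convex U" "U \<noteq> {}" and bin: "\<And>x j. x \<in> W \<Longrightarrow> x $ j \<in> {0, 1}"
    and le: "\<And>c. c \<in> U \<Longrightarrow> \<exists>x\<in>W. c \<bullet> x \<le> t"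
  obtains z where "z \<in> convex hull W" "\<And>c. c \<in> U \<Longrightarrow> c \<bullet> z \<le> t"
proof -
  obtain w0 where "w0 \<in> W" using le \<open>U \<noteq> {}\<close> by blast
  define ind :: "'n set \<Rightarrow> real ^ 'n" where "ind A = (\<chi> j. if j \<in> A then 1 else 0)" for A
  \<comment> \<open>Sets whose indicator vector is not in \<open>W\<close> are sent to
    \<open>w0\<close>, so the range is exactly \<open>W\<close>.\<close>
  define w where "w A = (if ind A \<in> W then ind A else w0)" for A
  have "x \<in> range w" if "x \<in> W" for x
  proof -
    have "ind {j. x $ j \<noteq> 0} = x"
      using bin[OF that] by (auto simp: ind_def vec_eq_iff)
    then show ?thesis
      using that by (intro range_eqI[of _ _ "{j. x $ j \<noteq> 0}"]) (simp add: w_def)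
  qed
  moreover have "range w \<subseteq> W" using \<open>w0 \<in> W\<close> by (auto simp: w_def)
  ultimately have "range w = W" by blast
  moreover have "\<exists>A. c \<bullet> w A \<le> t" if "c \<in> U" for c
    using le[OF that] \<open>range w = W\<close> by (metis imageE)
  ultimately show thesis
    using minimax_convex_hull_range[OF assms(1,2), of w t] that by auto
qed

section \<open>Representing points of convex hulls\<close>

text \<open>Caratheodory's theorem may leave one point too many. Sliding \<open>z\<close> down in
  all coordinates to the frontier of the hull then puts it in the hull of all but one of the
  points.\<close>

lemma convex_hull_decrease_caratheodory:
  fixes X :: "(real ^ 'n) set"
  assumes "z \<in> convex hull X"
  obtains S z' where "finite S" "S \<subseteq> X" "card S \<le> CARD('n)" "z' \<in> convex hull S"
    "\<And>j. z' $ j \<le> z $ j"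
proof -
  obtain S where S: "finite S" "S \<subseteq> X" "card S \<le> CARD('n) + 1" "z \<in> convex hull S"
    using assms by (subst (asm) caratheodory) auto
  show thesis
  proof (cases "card S \<le> CARD('n)")
    case True
    then show ?thesis using S that by blast
  next
    case False
    then have card: "card S = Suc CARD('n)" using S by simp
    have bounded: "bounded (convex hull S)"
      using S finite_imp_bounded bounded_convex_hull by blast
    have "\<exists>z'\<in>frontier (convex hull S). \<forall>j. z' $ j \<le> z $ j"
    proof (cases "z \<in> interior (convex hull S)")
      case True
      obtain d where "0 < d" "z + d *\<^sub>R (\<chi> j. - 1) \<in> frontier (convex hull S)"
        using ray_to_frontier[OF bounded True, of "\<chi> j. - 1"] by (auto simp: vec_eq_iff)
      then show ?thesis by (intro bexI) auto
    next
      case False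
      then show ?thesis
        using S by (auto simp: frontier_def intro!: bexI[of _ z] closure_subset[THEN subsetD])
    qed
    then obtain z' where z': "z' \<in> frontier (convex hull S)" "\<And>j. z' $ j \<le> z $ j" by blast
    obtain a where "a \<in> S" "z' \<in> convex hull (S - {a})"
      using z' card frontier_of_convex_hull[of S] by auto
    then show ?thesis
      using S z' card by (intro that[of "S - {a}" z']) auto
  qed
qed

text \<open>The combinations form a convex set containing every \<open>x i\<close>. Weights sit on
  indices rather than on points, so repeated vectors in the tuple are harmless.\<close>

lemma convex_hull_imp_combination:
  assumes "z \<in> convex hull (x ` {1..k})"
  obtains l where "l \<in> weights k" "combination k x l = z"
proof -
  have "convex ((combination k x) ` weights k)"
  proof (rule convexI)
    fix a b u v
    assume "a \<in> combination k x ` weights k" "b \<in> combination k x ` weights k"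
      and uv: "0 \<le> u" "0 \<le> v" "u + v = (1::real)"
    then obtain l l' where l: "l \<in> weights k" "a = combination k x l"
      and l': "l' \<in> weights k" "b = combination k x l'" by blast
    have "u *\<^sub>R a + v *\<^sub>R b = combination k x (\<lambda>i. u * l i + v * l' i)"
      unfolding l l' combination_def
      by (simp add: scaleR_sum_right scaleR_add_left sum.distrib)
    moreover have "(\<lambda>i. u * l i + v * l' i) \<in> weights k"
      using l l' uv by (simp add: weights_def sum.distrib sum_distrib_left[symmetric])
    ultimately show "u *\<^sub>R a + v *\<^sub>R b \<in> combination k x ` weights k" by blast
  qed
  moreover have "x i \<in> combination k x ` weights k" if "i \<in> {1..k}" for i
  proof
    have "combination k x (\<lambda>j. if j = i then 1 else 0) = (\<Sum>j=1..k. if j = i then x j else 0)"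
      unfolding combination_def by (intro sum.cong) auto
    then show "x i = combination k x (\<lambda>j. if j = i then 1 else 0)"
      using that by simp
    show "(\<lambda>j. if j = i then 1 else 0) \<in> weights k"
      using that by (simp add: weights_def)
  qed
  ultimately have "convex hull (x ` {1..k}) \<subseteq> combination k x ` weights k"
    by (intro hull_minimal) auto
  then show thesis using assms that by blast
qed

section \<open>Estimate for sorted weights\<close>

text \<open>Meant for \<open>a\<close> the cheapest selected cost, \<open>b\<close> the sorted
  weights and \<open>v\<close> the costs in that order. With \<open>T\<close> the weighted sum, the
  terms of \<open>a - T\<close> up to \<open>k\<close> are nonpositive and the others at most
  \<open>a / (k + 1)\<close>; moreover \<open>a \<le> hi / lo * T\<close>, as the average
  \<open>T\<close> is at least \<open>lo\<close>.\<close>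

lemma min_le_weighted_sum:
  fixes b v :: "nat \<Rightarrow> real"
  assumes "k \<le> n" and anti: "antimono_on {1..n} b"
    and nonneg: "\<And>j. j \<in> {1..n} \<Longrightarrow> 0 \<le> b j" and sum1: "(\<Sum>j=1..n. b j) = 1"
    and "0 < lo" and lo: "\<And>j. j \<in> {1..n} \<Longrightarrow> lo \<le> v j"
    and le: "\<And>j. j \<in> {1..k} \<Longrightarrow> a \<le> v j" and "0 \<le> a" "a \<le> hi"
  shows "a \<le> (1 + hi / lo * ((real n - real k) / (real k + 1))) * (\<Sum>j=1..n. b j * v j)"
proof -
  define T where "T = (\<Sum>j=1..n. b j * v j)"
  have small: "b j \<le> 1 / (real k + 1)" if j: "j \<in> {k+1..n}" for j
  proof -
    \<comment> \<open>Since \<open>j\<close> exceeds \<open>k\<close>, the first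
      \<open>k + 1\<close> weights are all at least \<open>b j\<close>; hence the denominator
      \<open>k + 1\<close> and not \<open>k\<close>.\<close>
    have "(real k + 1) * b j = (\<Sum>i=1..k+1. b j)" by simp
    also have "\<dots> \<le> (\<Sum>i=1..k+1. b i)"
      using j by (intro sum_mono monotone_onD[OF anti]) auto
    also have "\<dots> \<le> (\<Sum>i=1..n. b i)"
      using j nonneg by (intro sum_mono2) auto
    finally show ?thesis unfolding sum1 by (simp add: field_simps)
  qed
  have split: "{1..n} = {1..k} \<union> {k+1..n}" using \<open>k \<le> n\<close> by auto
  \<comment> \<open>The weights sum to 1, so \<open>a\<close> can be distributed over the
    terms.\<close>
  have "a - T = (\<Sum>j=1..n. b j * (a - v j))"
    using sum1 by (simp add: T_def right_diff_distrib sum_subtractf sum_distrib_right[symmetric])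
  also have "\<dots> = (\<Sum>j=1..k. b j * (a - v j)) + (\<Sum>j=k+1..n. b j * (a - v j))"
    unfolding split by (rule sum.union_disjoint) auto
  also have "\<dots> \<le> 0 + (\<Sum>j=k+1..n. 1 / (real k + 1) * a)"
  proof (intro add_mono sum_mono sum_nonpos)
    fix j assume "j \<in> {1..k}"
    then show "b j * (a - v j) \<le> 0"
      using le nonneg \<open>k \<le> n\<close> by (simp add: mult_nonneg_nonpos)
  next
    fix j assume j: "j \<in> {k+1..n}"
    then have "b j * (a - v j) \<le> b j * a"
      using nonneg[of j] lo[of j] \<open>0 < lo\<close> by (intro mult_left_mono) auto
    also have "\<dots> \<le> 1 / (real k + 1) * a"
      using small[OF j] \<open>0 \<le> a\<close> by (rule mult_right_mono)
    finally show "b j * (a - v j) \<le> 1 / (real k + 1) * a" .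
  qed
  also have "\<dots> = (real n - real k) / (real k + 1) * a"
    using \<open>k \<le> n\<close> by (simp add: of_nat_diff)
  also have "\<dots> \<le> (real n - real k) / (real k + 1) * (hi / lo * T)"
  proof (rule mult_left_mono)
    have "lo = (\<Sum>j=1..n. b j * lo)" using sum1 by (simp add: sum_distrib_right[symmetric])
    also have "\<dots> \<le> T"
      unfolding T_def using nonneg lo by (intro sum_mono mult_left_mono) auto
    finally have "hi / lo * lo \<le> hi / lo * T"
      using assms by (intro mult_left_mono) auto
    then show "a \<le> hi / lo * T" using \<open>a \<le> hi\<close> \<open>0 < lo\<close> by simp
  qed (use \<open>k \<le> n\<close> in auto)
  finally have "a \<le> T + (real n - real k) / (real k + 1) * (hi / lo * T)" by simp
  also have "\<dots> = (1 + hi / lo * ((real n - real k) / (real k + 1))) * T"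
    unfolding distrib_right by (simp only: mult_1 mult_ac)
  finally show ?thesis unfolding T_def .
qed

section \<open>Cost bounds and worst-case costs\<close>

lemma inner_binary_bounds:
  fixes c x :: "real ^ 'n"
  assumes "\<And>j. x $ j \<in> {0, 1}" "\<And>j. m \<le> c $ j" "\<And>j. c $ j \<le> M"
  shows "m * zero_norm x \<le> c \<bullet> x" and "c \<bullet> x \<le> M * zero_norm x"
proof -
  have "c \<bullet> x = (\<Sum>j\<in>{j. x $ j \<noteq> 0}. c $ j)"
    unfolding inner_vec_def using assms(1)
    by (intro sum.mono_neutral_cong_right) force+
  moreover have "(\<Sum>j\<in>{j. x $ j \<noteq> 0}. m) \<le> (\<Sum>j\<in>{j. x $ j \<noteq> 0}. c $ j)"
    "(\<Sum>j\<in>{j. x $ j \<noteq> 0}. c $ j) \<le> (\<Sum>j\<in>{j. x $ j \<noteq> 0}. M)"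
    using assms(2,3) by (auto simp del: sum_constant intro!: sum_mono)
  ultimately show "m * zero_norm x \<le> c \<bullet> x" "c \<bullet> x \<le> M * zero_norm x"
    by (simp_all add: zero_norm_def mult.commute)
qed

text \<open>Boundedness of \<open>U\<close> makes the suprema over \<open>U\<close> genuine upper
  bounds.\<close>

lemma cost_bounds_imp_bounded:
  assumes "cost_bounds U m M"
  shows "bounded U"
proof (rule bounded_subset)
  show "U \<subseteq> cbox (\<chi> j. m) (\<chi> j. M)"
    using assms by (auto simp: cost_bounds_def mem_box_cart)
qed simp

lemma bdd_above_inner:
  fixes z :: "'a::real_inner"
  assumes "bounded U"
  shows "bdd_above ((\<lambda>c. c \<bullet> z) ` U)"
  using assms by (intro bounded_imp_bdd_above bounded_linear_image bounded_linear_inner_left)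

lemma worst_cost_upper:
  assumes "bounded U" "c \<in> U" "1 \<le> k"
  shows "(MIN i\<in>{1..k}. c \<bullet> x i) \<le> worst_cost U k x"
  unfolding worst_cost_def
proof (rule cSUP_upper[OF \<open>c \<in> U\<close>])
  obtain B where "\<And>c. c \<in> U \<Longrightarrow> c \<bullet> x 1 \<le> B"
    using bdd_above_inner[OF \<open>bounded U\<close>, of "x 1"] by (auto simp: bdd_above_def)
  moreover have "(MIN i\<in>{1..k}. c \<bullet> x i) \<le> c \<bullet> x 1" for c
    using \<open>1 \<le> k\<close> by (intro Min_le) auto
  ultimately show "bdd_above ((\<lambda>c. MIN i\<in>{1..k}. c \<bullet> x i) ` U)"
    by (intro bdd_aboveI2[of _ _ B]) (meson order_trans)
qed

text \<open>For each \<open>c\<close> some entry of the tuple attains the minimum, so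
  \<open>minimax_binary\<close> applies with \<open>t\<close> the worst-case cost of the
  tuple.\<close>

lemma minimax_tuple:
  fixes U :: "(real ^ 'n) set"
  assumes "convex U" "U \<noteq> {}" "bounded U" "1 \<le> k"
    and bin: "\<And>i j. i \<in> {1..k} \<Longrightarrow> x i $ j \<in> {0, 1}"
  obtains z where "z \<in> convex hull (x ` {1..k})" "\<And>c. c \<in> U \<Longrightarrow> c \<bullet> z \<le> worst_cost U k x"
proof -
  have "\<exists>v\<in>x ` {1..k}. c \<bullet> v \<le> worst_cost U k x" if "c \<in> U" for c
  proof -
    have "(MIN i\<in>{1..k}. c \<bullet> x i) \<in> (\<lambda>i. c \<bullet> x i) ` {1..k}"
      using \<open>1 \<le> k\<close> by (intro Min_in) auto
    then show ?thesis
      using worst_cost_upper[OF \<open>bounded U\<close> that \<open>1 \<le> k\<close>, of x] by auto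
  qed
  then show thesis
    using minimax_binary[OF assms(1,2), of "x ` {1..k}" "worst_cost U k x"] bin that by blast
qed

text \<open>Counterpart of \<open>minimax_tuple\<close>: on the hull, a linear function is never
  below its minimum over the tuple.\<close>

lemma worst_cost_le_of_convex_hull:
  assumes "U \<noteq> {}" "z \<in> convex hull (x ` {1..k})" "\<And>c. c \<in> U \<Longrightarrow> c \<bullet> z \<le> t"
  shows "worst_cost U k x \<le> t"
  unfolding worst_cost_def
proof (rule cSUP_least[OF \<open>U \<noteq> {}\<close>])
  fix c assume "c \<in> U"
  define a where "a = (MIN i\<in>{1..k}. c \<bullet> x i)"
  have "convex hull (x ` {1..k}) \<subseteq> {v. a \<le> c \<bullet> v}"
    by (intro hull_minimal) (auto simp: a_def convex_halfspace_ge)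
  then show "(MIN i\<in>{1..k}. c \<bullet> x i) \<le> t"
    using assms(2) assms(3)[OF \<open>c \<in> U\<close>] by (auto simp: a_def)
qed

text \<open>Here \<open>k\<close> may exceed the dimension. The tuple \<open>w\<close> is replaced
  by a hull point \<open>z\<close>, then by a lower point \<open>z'\<close> in the hull of at most
  \<open>CARD('n)\<close> of its vectors, which form a competitor \<open>g\<close> for the optimal
  tuple.\<close>

lemma optimal_tuple_le:
  fixes X U :: "(real ^ 'n) set"
  assumes inst: "is_instance X U" and "bounded U" and opt: "optimal_tuple X U CARD('n) x"
    and "1 \<le> k" and w: "w \<in> {1..k} \<rightarrow> X"
  shows "worst_cost U CARD('n) x \<le> worst_cost U k w"
proof -
  have U: "convex U" "U \<noteq> {}" "\<And>c j. c \<in> U \<Longrightarrow> 0 \<le> c $ j"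
    and X: "\<And>x j. x \<in> X \<Longrightarrow> x $ j \<in> {0, 1}"
    using inst by (auto simp: is_instance_def)
  obtain z where z: "z \<in> convex hull (w ` {1..k})" "\<And>c. c \<in> U \<Longrightarrow> c \<bullet> z \<le> worst_cost U k w"
    using minimax_tuple[OF U(1,2) \<open>bounded U\<close> \<open>1 \<le> k\<close>, of w] X[OF Pi_mem[OF w]] by blast
  obtain S z' where S: "finite S" "S \<subseteq> w ` {1..k}" "card S \<le> CARD('n)" "z' \<in> convex hull S"
    and z': "\<And>j. z' $ j \<le> z $ j"
    by (rule convex_hull_decrease_caratheodory[OF z(1)]) blast
  have "S \<noteq> {}" using S by auto
  \<comment> \<open>Repetitions fill the list up to exactly \<open>CARD('n)\<close> entries.\<close>
  then obtain g where g: "S = g ` {1..CARD('n)}"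
    using S(1,3) inj_on_iff_surj[of S "{1..CARD('n)}"] card_le_inj[of S "{1..CARD('n)}"] by auto
  have "g \<in> {1..CARD('n)} \<rightarrow> X"
  proof
    fix i assume "i \<in> {1..CARD('n)}"
    then have "g i \<in> w ` {1..k}" using g S(2) by auto
    then show "g i \<in> X" using w by auto
  qed
  then have "worst_cost U CARD('n) x \<le> worst_cost U CARD('n) g"
    using opt by (simp add: optimal_tuple_def is_arg_min_linorder)
  also have "\<dots> \<le> worst_cost U k w"
  proof (rule worst_cost_le_of_convex_hull[OF U(2)])
    show "z' \<in> convex hull (g ` {1..CARD('n)})" using S(4) unfolding g .
    fix c assume c: "c \<in> U"
    have "c \<bullet> z' \<le> c \<bullet> z"
      unfolding inner_vec_def using U(3)[OF c] z' by (auto intro!: sum_mono mult_left_mono)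
    also have "\<dots> \<le> worst_cost U k w" by (rule z(2)[OF c])
    finally show "c \<bullet> z' \<le> worst_cost U k w" .
  qed
  finally show ?thesis .
qed

text \<open>By \<open>minimax_tuple\<close>, some point of the hull of the optimal tuple costs at
  most the value of that tuple, and \<open>l\<close> does at least as well as the weights of that
  point. \<open>optimal_tuple_le\<close> then compares with every \<open>k\<close>-tuple.\<close>

lemma optimal_combination_le_opt:
  fixes X U :: "(real ^ 'n) set"
  assumes inst: "is_instance X U" and "bounded U" and opt: "optimal_tuple X U CARD('n) x"
    and l: "optimal_weights U CARD('n) x l" and "1 \<le> k" and "c \<in> U"
  shows "c \<bullet> combination CARD('n) x l \<le> opt X U k"
proof -
  let ?n = "CARD('n)"
  have U: "convex U" "U \<noteq> {}"
    and X: "X \<noteq> {}" "\<And>x j. x \<in> X \<Longrightarrow> x $ j \<in> {0, 1}"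
    using inst by (auto simp: is_instance_def)
  have xX: "x i \<in> X" if "i \<in> {1..?n}" for i
    using opt that by (auto simp: optimal_tuple_def is_arg_min_def)
  obtain z where z: "z \<in> convex hull (x ` {1..?n})" "\<And>c. c \<in> U \<Longrightarrow> c \<bullet> z \<le> worst_cost U ?n x"
    using minimax_tuple[OF U \<open>bounded U\<close>, of ?n x] X(2)[OF xX] by (auto simp: Suc_leI)
  obtain l' where l': "l' \<in> weights ?n" "combination ?n x l' = z"
    using convex_hull_imp_combination[OF z(1)] by blast
  have "c \<bullet> combination ?n x l \<le> (SUP c\<in>U. c \<bullet> combination ?n x l)"
    using \<open>c \<in> U\<close> bdd_above_inner[OF \<open>bounded U\<close>] by (rule cSUP_upper)
  also have "\<dots> \<le> (SUP c\<in>U. c \<bullet> z)"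
    using l l' by (auto simp: optimal_weights_def is_arg_min_linorder)
  also have "\<dots> \<le> worst_cost U ?n x"
    using U z by (intro cSUP_least) auto
  also have "\<dots> \<le> opt X U k"
    unfolding opt_def
    using X(1) optimal_tuple_le[OF inst \<open>bounded U\<close> opt \<open>1 \<le> k\<close>]
    by (intro cINF_greatest) auto
  finally show ?thesis .
qed

section \<open>The approximation guarantee\<close>

theorem corollary10:
  fixes X U :: "(real ^ 'n) set"
    and C :: "((real ^ 'n) set \<times> (real ^ 'n) set) set"
    and p_lo p_hi :: "nat \<Rightarrow> real"
    and m M :: real
    and k :: nat
    and y :: "nat \<Rightarrow> real ^ 'n"
  assumes "is_instance X U"
    and "(X, U) \<in> C"
    and "cardinality_bounds C p_lo p_hi"
    and "p_lo CARD('n) > 0"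
    and "cost_bounds U m M"
    and "k \<in> {1..CARD('n)}"
    and "selection_output X U k y"
  shows "\<forall>k'\<ge>k. worst_cost U k y \<le>
    (1 + M_tilde m M p_lo p_hi CARD('n) * ((real CARD('n) - real k) / (real k + 1))) * opt X U k'"
proof (intro allI impI)
  fix k' assume "k \<le> k'"
  let ?n = "CARD('n)"
  let ?lo = "m * p_lo ?n" and ?hi = "M * p_hi ?n"
  define F where "F = 1 + M_tilde m M p_lo p_hi ?n * ((real ?n - real k) / (real k + 1))"
  \<comment> \<open>\<open>M_tilde\<close> is the ratio of the bounds \<open>?hi\<close> and
    \<open>?lo\<close> on the cost of a vector of \<open>X\<close>.\<close>
  have F: "F = 1 + ?hi / ?lo * ((real ?n - real k) / (real k + 1))"
    by (simp add: F_def M_tilde_def)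
  have U: "U \<noteq> {}" and X: "\<And>x j. x \<in> X \<Longrightarrow> x $ j \<in> {0, 1}"
    using assms(1) by (auto simp: is_instance_def)
  have mM: "0 < m" "m \<le> M" "\<And>c j. c \<in> U \<Longrightarrow> m \<le> c $ j" "\<And>c j. c \<in> U \<Longrightarrow> c $ j \<le> M"
    using assms(5) by (auto simp: cost_bounds_def)
  have card: "p_lo ?n \<le> real (zero_norm x)" "real (zero_norm x) \<le> p_hi ?n" if "x \<in> X" for x
    using assms(2,3) that by (auto simp: cardinality_bounds_def)
  have "0 \<le> p_hi ?n" using assms(3) by (simp add: cardinality_bounds_def Suc_leI)
  have "0 < ?lo" using mM assms(4) by simp
  have "0 \<le> F"
    unfolding F using mM assms(6) \<open>0 < ?lo\<close> \<open>0 \<le> p_hi ?n\<close> by simp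
  have cost: "?lo \<le> c \<bullet> x" "c \<bullet> x \<le> ?hi" if "c \<in> U" "x \<in> X" for c x
  proof -
    note b = inner_binary_bounds[of x m c M, OF X[OF that(2)] mM(3,4)[OF that(1)]]
    have "?lo \<le> m * zero_norm x" using mM card[OF that(2)] by simp
    with b(1) show "?lo \<le> c \<bullet> x" by linarith
    have "M * zero_norm x \<le> ?hi" using mM card[OF that(2)] by simp
    with b(2) show "c \<bullet> x \<le> ?hi" by linarith
  qed
  obtain x l s where opt: "optimal_tuple X U ?n x" and l: "optimal_weights U ?n x l"
    and s: "bij_betw s {1..?n} {1..?n}" and anti: "antimono_on {1..?n} (\<lambda>j. l (s j))"
    and y: "\<And>j. j \<in> {1..k} \<Longrightarrow> y j = x (s j)"
    using assms(7) by (auto simp: selection_output_def)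
  have s_in: "s j \<in> {1..?n}" if "j \<in> {1..?n}" for j
    using s that by (auto simp: bij_betw_def)
  have xs: "x (s j) \<in> X" if "j \<in> {1..?n}" for j
    using opt s_in[OF that] by (auto simp: optimal_tuple_def is_arg_min_def)
  have w: "\<And>i. i \<in> {1..?n} \<Longrightarrow> 0 \<le> l i" "(\<Sum>i=1..?n. l i) = 1"
    using l by (auto simp: optimal_weights_def is_arg_min_def weights_def)
  have "(MIN i\<in>{1..k}. c \<bullet> y i) \<le> F * opt X U k'" if c: "c \<in> U" for c
  proof -
    define a where "a = (MIN i\<in>{1..k}. c \<bullet> y i)"
    have a_le: "a \<le> c \<bullet> x (s j)" if "j \<in> {1..k}" for j
      unfolding a_def y[OF that, symmetric] using that by (intro Min_le) auto
    \<comment> \<open>The minimum is the cost of a selected vector and so inherits both cost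
      bounds.\<close>
    have "a \<in> (\<lambda>i. c \<bullet> y i) ` {1..k}"
      unfolding a_def using assms(6) by (intro Min_in) auto
    then obtain i where i: "i \<in> {1..k}" "a = c \<bullet> x (s i)" using y by auto
    have a: "?lo \<le> a" "a \<le> ?hi"
      using cost[OF c xs[of i]] i assms(6) by auto
    have "a \<le> F * (\<Sum>j=1..?n. l (s j) * (c \<bullet> x (s j)))"
      unfolding F
    proof (rule min_le_weighted_sum)
      show "k \<le> ?n" "antimono_on {1..?n} (\<lambda>j. l (s j))" "0 < ?lo" "a \<le> ?hi" "0 \<le> a"
        using assms(6) anti \<open>0 < ?lo\<close> a by auto
      show "(\<Sum>j=1..?n. l (s j)) = 1"
        using sum.reindex_bij_betw[OF s, of l] w(2) by simp
    qed (use w s_in cost[OF c] xs a_le in auto)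
    also have "(\<Sum>j=1..?n. l (s j) * (c \<bullet> x (s j))) = c \<bullet> combination ?n x l"
      using sum.reindex_bij_betw[OF s, of "\<lambda>i. l i * (c \<bullet> x i)"]
      by (simp add: combination_def inner_sum_right)
    also have "F * (c \<bullet> combination ?n x l) \<le> F * opt X U k'"
    proof (rule mult_left_mono[OF _ \<open>0 \<le> F\<close>])
      show "c \<bullet> combination ?n x l \<le> opt X U k'"
        by (rule optimal_combination_le_opt[OF assms(1) cost_bounds_imp_bounded[OF assms(5)] opt l _ c])
          (use assms(6) \<open>k \<le> k'\<close> in auto)
    qed
    finally show ?thesis by (simp add: a_def)
  qed
  then have "worst_cost U k y \<le> F * opt X U k'"
    unfolding worst_cost_def by (intro cSUP_least[OF U])
  then show "worst_cost U k y \<le> (1 + M_tilde m M p_lo p_hi ?n *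
      ((real ?n - real k) / (real k + 1))) * opt X U k'"
    by (simp add: F_def)
qed

end
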